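(* For each integer $N\ge 3$, let $x_{N,1}>x_{N,2}>\cdots>x_{N,N}$ be the unique strictly decreasing solution of the recursion relation $$x_{N,n+1}=x_{N,n}-\frac{1}{x_{N,1}+\cdots+x_{N,n}},\qquad n=1,\ldots,N-1,$$ satisfying $x_{N,1}+\cdots+x_{N,N}=0$. Let $\mathbb{P}_N$ be its empirical distribution, $\mathbb{P}_N(A)=\#\{n\colon x_{N,n}\in A\}/N$ for Borel sets $A\subset\mathbb{R}$, and let $\mathcal{N}$ denote the Gaussian distribution with the same mean and variance as $\mathbb{P}_N$. Then the Wasserstein distance satisfies $$d_W(\mathbb{P}_N,\mathcal{N})\le \frac{4\,x_{N,1}}{N-1}$$ and $$d_W(\mathbb{P}_N,\mathcal{N})\le \frac{4}{\sqrt{\log N}}.$$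
   Context: A solution of the recursion is a finite sequence of real numbers $x_{N,1},\ldots,x_{N,N}$ for which all partial sums $x_{N,1}+\cdots+x_{N,n}$, $1\le n\le N-1$, are nonzero and the recursion holds for $n=1,\ldots,N-1$. For each $N\ge 3$ a strictly decreasing zero-mean solution exists and is unique. For probability distributions $\mu,\nu$ on $\mathbb{R}$ (with finite first moment), $d_W(\mu,\nu)=\sup_{h\in\mathcal{L}}|Eh(X)-Eh(Y)|$, where $X\sim\mu$, $Y\sim\nu$, and $\mathcal{L}$ is the collection of functions $h\colon\mathbb{R}\to\mathbb{R}$ with $|h(x)-h(y)|\le|x-y|$ for all $x,y$. *)

theory Defs
  imports "HOL-Probability.Probability"
begin

definition recursion_solution :: "nat \<Rightarrow> (nat \<Rightarrow> real) \<Rightarrow> bool" where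
  "recursion_solution N x \<longleftrightarrow>
     (\<forall>n\<in>{1..N - 1}. (\<Sum>k=1..n. x k) \<noteq> 0 \<and> x (n + 1) = x n - 1 / (\<Sum>k=1..n. x k))"

definition empirical_distribution :: "nat \<Rightarrow> (nat \<Rightarrow> real) \<Rightarrow> real measure" where
  "empirical_distribution N x = distr (uniform_count_measure {1..N}) borel x"

lemma measure_empirical_distribution:
  assumes "N \<ge> 1" and "A \<in> sets borel"
  shows "measure (empirical_distribution N x) A = real (card {n\<in>{1..N}. x n \<in> A}) / real N"
proof -
  have x: "x \<in> measurable (uniform_count_measure {1..N}) borel"
    by (simp add: measurable_def space_uniform_count_measure sets_uniform_count_measure)
  have e: "x -` A \<inter> {1..N} = {n\<in>{1..N}. x n \<in> A}"
    by auto
  have "measure (uniform_count_measure {1..N}) {n\<in>{1..N}. x n \<in> A}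
      = card {n\<in>{1..N}. x n \<in> A} / card {1..N}"
    by (rule measure_uniform_count_measure) auto
  then show ?thesis
    unfolding empirical_distribution_def measure_distr[OF x assms(2)] space_uniform_count_measure e
    by simp
qed

definition mean :: "real measure \<Rightarrow> real" where
  "mean M = (\<integral>x. x \<partial>M)"

definition variance :: "real measure \<Rightarrow> real" where
  "variance M = (\<integral>x. (x - mean M)\<^sup>2 \<partial>M)"

text \<open>The second parameter of \<^const>\<open>normal_density\<close> is the standard deviation.
  The Gaussian is a probability measure only if the variance of M is positive.\<close>

definition matching_gaussian :: "real measure \<Rightarrow> real measure" where
  "matching_gaussian M = density lborel (normal_density (mean M) (sqrt (variance M)))"

text \<open>Meant for probability measures with finite first moment, for which every Lipschitz function
  is integrable. The supremum is taken in the extended reals, so that a bound on it bounds every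
  member of the family.\<close>

definition wasserstein_dist :: "real measure \<Rightarrow> real measure \<Rightarrow> ereal" where
  "wasserstein_dist M M' =
     (SUP h\<in>{h :: real \<Rightarrow> real. \<forall>x y. \<bar>h x - h y\<bar> \<le> \<bar>x - y\<bar>}.
        ereal \<bar>(\<integral>x. h x \<partial>M) - (\<integral>x. h x \<partial>M')\<bar>)"

end

(* Stein's method. Let v = (N-1)/N be the variance (summation by parts gives sum x_n^2 = N-1). For a
   1-Lipschitz h with Gaussian mean c, the equation v f'(w) - w f(w) = h(w) - c has a solution with
   v f' 2-Lipschitz. The recursion says that the n-th partial sum is the reciprocal of the gap
   x_n - x_{n+1}, so summing the equation over the points compares f' at the end points of each gap
   with f' at an intermediate point; the error is at most 2 (x_1 - x_N)/(N-1) in total. Finally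
   x_N = -x_1, because a solution is monotone in its first term and the reflected sequence is also
   a solution. The second bound follows from x_1^2 <= sum x_n^2 = N-1 and ln N <= N-1. *)
theory Submission
  imports Defs "HOL-Real_Asymp.Real_Asymp"
begin

section \<open>Integrals over half-lines\<close>

lemma set_integrable_of_integrable:
  fixes g :: "real \<Rightarrow> real"
  assumes "integrable lborel g" "A \<in> sets borel"
  shows "set_integrable lborel A g"
  unfolding set_integrable_def by (rule integrable_mult_indicator) (use assms in auto)

text \<open>The fundamental theorem on the open half-line below \<open>w\<close>: \<open>G\<close>
  vanishes at the lower end, so only the boundary term at \<open>w\<close> survives. The end point
  is a null set.\<close>

lemma set_integral_atMost_eq_antiderivative:
  fixes g G :: "real \<Rightarrow> real"
  assumes "\<And>t. (G has_real_derivative g t) (at t)" and cont: "continuous_on UNIV g"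
    and int: "integrable lborel g" and lim: "(G \<longlongrightarrow> 0) at_bot"
  shows "(LINT t:{..w}|lborel. g t) = G w"
proof -
  have "(LBINT t=-\<infinity>..ereal w. g t) = G w - 0"
  proof (rule interval_integral_FTC_integrable)
    show "(G has_vector_derivative g x) (at x)" for x
      using assms(1) by (simp add: has_real_derivative_iff_has_vector_derivative)
    show "isCont g x" for x
      using cont by (simp add: continuous_on_eq_continuous_at)
    show "set_integrable lborel (einterval (-\<infinity>) (ereal w)) g"
      using int by (rule set_integrable_of_integrable) simp
    show "((G \<circ> real_of_ereal) \<longlongrightarrow> 0) (at_right (-\<infinity>))"
      using lim by (simp add: ereal_tendsto_simps)
    have "isCont G w" using assms(1) DERIV_isCont by blast
    then show "((G \<circ> real_of_ereal) \<longlongrightarrow> G w) (at_left (ereal w))"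
      by (simp add: ereal_tendsto_simps isCont_def filterlim_at_split)
  qed simp
  moreover have "(LBINT t=-\<infinity>..ereal w. g t) = (LINT t:{..<w}|lborel. g t)"
    by (simp add: interval_lebesgue_integral_def einterval_def lessThan_def)
  moreover have "(LINT t:{..<w}|lborel. g t) = (LINT t:{..w}|lborel. g t)"
    unfolding set_lebesgue_integral_def
    by (rule integral_cong_AE) (use int AE_lborel_singleton[of w] in \<open>auto elim!: eventually_mono split: split_indicator\<close>)
  ultimately show ?thesis by simp
qed

text \<open>For \<open>u\<close> near \<open>w\<close> the integral splits at \<open>w - 1\<close>:
  the part below is constant in \<open>u\<close>, and the rest is an integral over a compact
  interval, to which the fundamental theorem applies.\<close>

lemma DERIV_set_integral_atMost:
  fixes g :: "real \<Rightarrow> real"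
  assumes cont: "continuous_on UNIV g" and int: "integrable lborel g"
  shows "((\<lambda>w. LINT t:{..w}|lborel. g t) has_real_derivative g w) (at w)"
proof -
  have si: "set_integrable lborel A g" if "A \<in> sets borel" for A
    using int that by (rule set_integrable_of_integrable)
  let ?H = "\<lambda>u. (LINT t:{..w-1}|lborel. g t) + integral {w-1..u} g"
  have eq: "(LINT t:{..u}|lborel. g t) = ?H u" if "u \<in> {w-1<..<w+1}" for u
  proof -
    have "{..u} = {..w-1} \<union> {w-1<..u}" using that by auto
    moreover have "(LINT t:{..w-1} \<union> {w-1<..u}|lborel. g t)
        = (LINT t:{..w-1}|lborel. g t) + (LINT t:{w-1<..u}|lborel. g t)"
      by (rule set_integral_Un) (auto simp: si)
    ultimately have "(LINT t:{..u}|lborel. g t) = (LINT t:{..w-1}|lborel. g t) + (LINT t:{w-1<..u}|lborel. g t)"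
      by simp
    also have "(LINT t:{w-1<..u}|lborel. g t) = (LINT t:{w-1..u}|lborel. g t)"
      unfolding set_lebesgue_integral_def
      by (rule integral_cong_AE) (use int AE_lborel_singleton[of "w-1"] in \<open>auto elim!: eventually_mono split: split_indicator\<close>)
    also have "\<dots> = integral {w-1..u} g"
      by (rule set_borel_integral_eq_integral) (simp add: si)
    finally show ?thesis .
  qed
  have "((\<lambda>u. integral {w-1..u} g) has_vector_derivative g w) (at w within {w-1..w+1})"
    by (rule integral_has_vector_derivative) (auto intro: continuous_on_subset[OF cont])
  then have "((\<lambda>u. integral {w-1..u} g) has_real_derivative g w) (at w)"
    by (simp add: has_real_derivative_iff_has_vector_derivative at_within_Icc_at)
  then have "(?H has_real_derivative g w) (at w)"
    by (auto intro!: derivative_eq_intros)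
  then show ?thesis
    by (rule has_field_derivative_transform_within_open[of _ _ _ "{w-1<..<w+1}"]) (auto simp: eq)
qed

section \<open>Truncated moments of the centred Gaussian\<close>

lemma DERIV_normal_density:
  assumes "\<sigma> > 0"
  shows "(normal_density 0 \<sigma> has_real_derivative - t * normal_density 0 \<sigma> t / \<sigma>\<^sup>2) (at t)"
  unfolding normal_density_def using assms
  by (auto intro!: derivative_eq_intros simp: field_simps power2_eq_square)

lemma continuous_on_normal_density [continuous_intros]:
  "continuous_on A (normal_density \<mu> \<sigma>)"
  unfolding normal_density_def by (cases "\<sigma> = 0") (auto intro!: continuous_intros)

lemma normal_density_zero_at_bot:
  assumes "\<sigma> > 0"
  shows "(normal_density 0 \<sigma> \<longlongrightarrow> 0) at_bot"
    and "((\<lambda>t. t * normal_density 0 \<sigma> t) \<longlongrightarrow> 0) at_bot"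
  unfolding normal_density_def using assms by real_asymp+

lemma set_integral_atMost_greaterThan:
  fixes g :: "real \<Rightarrow> real"
  assumes "integrable lborel g"
  shows "(LINT t:{..w}|lborel. g t) + (LINT t:{w<..}|lborel. g t) = (\<integral>t. g t \<partial>lborel)"
proof -
  have "(LINT t:{..w} \<union> {w<..}|lborel. g t) = (LINT t:{..w}|lborel. g t) + (LINT t:{w<..}|lborel. g t)"
    by (rule set_integral_Un) (auto intro!: set_integrable_of_integrable assms)
  moreover have "{..w} \<union> {w<..} = UNIV" by auto
  ultimately show ?thesis by (simp add: set_lebesgue_integral_def)
qed

context
  fixes \<sigma> w :: real
  assumes sigma_pos: "\<sigma> > 0"
begin

abbreviation (input) "\<phi> \<equiv> normal_density 0 \<sigma>"

lemma integrable_monomial_normal: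
  "integrable lborel (\<lambda>t. t * \<phi> t)" "integrable lborel (\<lambda>t. t\<^sup>2 * \<phi> t)"
  using integrable_normal_moment[OF sigma_pos, of 0 1] integrable_normal_moment[OF sigma_pos, of 0 2]
  by (simp_all add: mult.commute)

text \<open>Since the density has derivative \<open>- t * \<phi> t / \<sigma>\<^sup>2\<close>,
  explicit antiderivatives exist for \<open>t * \<phi> t\<close> and for
  \<open>(t\<^sup>2 - \<sigma>\<^sup>2) * \<phi> t\<close>. The upper half-lines follow by
  subtraction from the full moments 0 and \<open>\<sigma>\<^sup>2\<close>.\<close>

lemma normal_half_line_moments:
  shows "(LINT t:{..w}|lborel. t * \<phi> t) = - (\<sigma>\<^sup>2 * \<phi> w)"
    and "(LINT t:{w<..}|lborel. t * \<phi> t) = \<sigma>\<^sup>2 * \<phi> w"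
    and "(LINT t:{..w}|lborel. t\<^sup>2 * \<phi> t) = \<sigma>\<^sup>2 * (LINT t:{..w}|lborel. \<phi> t) - \<sigma>\<^sup>2 * w * \<phi> w"
    and "(LINT t:{w<..}|lborel. t\<^sup>2 * \<phi> t) = \<sigma>\<^sup>2 * (LINT t:{w<..}|lborel. \<phi> t) + \<sigma>\<^sup>2 * w * \<phi> w"
proof -
  note I = integrable_monomial_normal integrable_normal_density[OF sigma_pos, of 0]
  note S = set_integrable_of_integrable
  show 1: "(LINT t:{..w}|lborel. t * \<phi> t) = - (\<sigma>\<^sup>2 * \<phi> w)"
  proof (rule set_integral_atMost_eq_antiderivative)
    show "((\<lambda>t. - (\<sigma>\<^sup>2 * \<phi> t)) has_real_derivative t * \<phi> t) (at t)" for t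
      using sigma_pos by (auto intro!: derivative_eq_intros DERIV_normal_density)
    show "((\<lambda>t. - (\<sigma>\<^sup>2 * \<phi> t)) \<longlongrightarrow> 0) at_bot"
      using tendsto_mult_right_zero[OF normal_density_zero_at_bot(1)[OF sigma_pos], of "- \<sigma>\<^sup>2"] by simp
  qed (use I in \<open>auto intro!: continuous_intros\<close>)
  have 2: "(LINT t:{..w}|lborel. t\<^sup>2 * \<phi> t - \<sigma>\<^sup>2 * \<phi> t) = - (\<sigma>\<^sup>2 * (w * \<phi> w))"
  proof (rule set_integral_atMost_eq_antiderivative)
    show "((\<lambda>t. - (\<sigma>\<^sup>2 * (t * \<phi> t))) has_real_derivative t\<^sup>2 * \<phi> t - \<sigma>\<^sup>2 * \<phi> t) (at t)" for t
      using sigma_pos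
      by (auto intro!: derivative_eq_intros DERIV_normal_density simp: field_simps power2_eq_square)
    show "((\<lambda>t. - (\<sigma>\<^sup>2 * (t * \<phi> t))) \<longlongrightarrow> 0) at_bot"
      using tendsto_mult_right_zero[OF normal_density_zero_at_bot(2)[OF sigma_pos], of "- \<sigma>\<^sup>2"] by simp
  qed (use I in \<open>auto intro!: continuous_intros\<close>)
  show 3: "(LINT t:{..w}|lborel. t\<^sup>2 * \<phi> t) = \<sigma>\<^sup>2 * (LINT t:{..w}|lborel. \<phi> t) - \<sigma>\<^sup>2 * w * \<phi> w"
    using 2 I by (simp add: set_integral_diff S)
  have "(\<integral>t. t * \<phi> t \<partial>lborel) = 0"
    using integral_normal_moment_nz_1[OF sigma_pos, of 0] by (simp add: mult.commute)
  then show "(LINT t:{w<..}|lborel. t * \<phi> t) = \<sigma>\<^sup>2 * \<phi> w"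
    using set_integral_atMost_greaterThan[OF I(1), of w] 1 by simp
  have "(\<integral>t. t\<^sup>2 * \<phi> t \<partial>lborel) = \<sigma>\<^sup>2"
    using integral_normal_moment_even[OF sigma_pos, of 0 1] by (simp add: mult.commute)
  then have "(LINT t:{..w}|lborel. t\<^sup>2 * \<phi> t) + (LINT t:{w<..}|lborel. t\<^sup>2 * \<phi> t)
      = \<sigma>\<^sup>2 * ((LINT t:{..w}|lborel. \<phi> t) + (LINT t:{w<..}|lborel. \<phi> t))"
    using set_integral_atMost_greaterThan[OF I(2), of w] set_integral_atMost_greaterThan[OF I(3), of w]
      sigma_pos by simp
  then show "(LINT t:{w<..}|lborel. t\<^sup>2 * \<phi> t) = \<sigma>\<^sup>2 * (LINT t:{w<..}|lborel. \<phi> t) + \<sigma>\<^sup>2 * w * \<phi> w"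
    using 3 by (simp add: algebra_simps)
qed

lemma set_integral_quadratic_normal:
  assumes "A \<in> sets borel"
  shows "(LINT t:A|lborel. (a + b * t + c * t\<^sup>2) * \<phi> t) =
    a * (LINT t:A|lborel. \<phi> t) + b * (LINT t:A|lborel. t * \<phi> t) + c * (LINT t:A|lborel. t\<^sup>2 * \<phi> t)"
  using integrable_monomial_normal integrable_normal_density[OF sigma_pos, of 0] assms
  by (simp add: distrib_right mult.assoc set_integral_add set_integrable_of_integrable)

text \<open>The first moments will bound the integrals of \<open>h t - h w\<close> on either side of
  \<open>w\<close> for 1-Lipschitz \<open>h\<close>; the second moments will be the coefficients of
  those integrals.\<close>

lemma normal_truncated_moments:
  shows "(LINT t:{..w}|lborel. (w - t) * \<phi> t) = w * (LINT t:{..w}|lborel. \<phi> t) + \<sigma>\<^sup>2 * \<phi> w"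
    and "(LINT t:{w<..}|lborel. (t - w) * \<phi> t) = \<sigma>\<^sup>2 * \<phi> w - w * (LINT t:{w<..}|lborel. \<phi> t)"
    and "(LINT t:{..w}|lborel. (t - w)\<^sup>2 * \<phi> t) = (\<sigma>\<^sup>2 + w\<^sup>2) * (LINT t:{..w}|lborel. \<phi> t) + \<sigma>\<^sup>2 * w * \<phi> w"
    and "(LINT t:{w<..}|lborel. (t - w)\<^sup>2 * \<phi> t) = (\<sigma>\<^sup>2 + w\<^sup>2) * (LINT t:{w<..}|lborel. \<phi> t) - \<sigma>\<^sup>2 * w * \<phi> w"
proof -
  have e: "w - t = w + (-1) * t + 0 * t\<^sup>2" "t - w = - w + 1 * t + 0 * t\<^sup>2"
    "(t - w)\<^sup>2 = w\<^sup>2 + (- 2 * w) * t + 1 * t\<^sup>2" for t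
    by (simp_all add: power2_eq_square algebra_simps)
  note q = set_integral_quadratic_normal
  show "(LINT t:{..w}|lborel. (w - t) * \<phi> t) = w * (LINT t:{..w}|lborel. \<phi> t) + \<sigma>\<^sup>2 * \<phi> w"
    unfolding e(1) by (subst q) (simp_all add: normal_half_line_moments)
  show "(LINT t:{w<..}|lborel. (t - w) * \<phi> t) = \<sigma>\<^sup>2 * \<phi> w - w * (LINT t:{w<..}|lborel. \<phi> t)"
    unfolding e(2) by (subst q) (simp_all add: normal_half_line_moments)
  show "(LINT t:{..w}|lborel. (t - w)\<^sup>2 * \<phi> t) = (\<sigma>\<^sup>2 + w\<^sup>2) * (LINT t:{..w}|lborel. \<phi> t) + \<sigma>\<^sup>2 * w * \<phi> w"
    unfolding e(3) by (subst q) (simp_all add: normal_half_line_moments, simp add: algebra_simps power2_eq_square)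
  show "(LINT t:{w<..}|lborel. (t - w)\<^sup>2 * \<phi> t) = (\<sigma>\<^sup>2 + w\<^sup>2) * (LINT t:{w<..}|lborel. \<phi> t) - \<sigma>\<^sup>2 * w * \<phi> w"
    unfolding e(3) by (subst q) (simp_all add: normal_half_line_moments, simp add: algebra_simps power2_eq_square)
qed

end

section \<open>The Stein equation for Lipschitz test functions\<close>

lemma abs_set_integral_le:
  fixes g k :: "real \<Rightarrow> real"
  assumes "integrable lborel g" "integrable lborel k" "A \<in> sets borel"
    and "\<And>t. t \<in> A \<Longrightarrow> \<bar>g t\<bar> \<le> k t"
  shows "\<bar>LINT t:A|lborel. g t\<bar> \<le> (LINT t:A|lborel. k t)"
proof -
  have "\<bar>LINT t:A|lborel. g t\<bar> \<le> (\<integral>t. \<bar>indicator A t *\<^sub>R g t\<bar> \<partial>lborel)"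
    unfolding set_lebesgue_integral_def by (rule integral_abs_bound)
  also have "\<dots> \<le> (\<integral>t. indicator A t *\<^sub>R k t \<partial>lborel)"
  proof (rule integral_mono)
    show "integrable lborel (\<lambda>t. \<bar>indicator A t *\<^sub>R g t\<bar>)" "integrable lborel (\<lambda>t. indicator A t *\<^sub>R k t)"
      using assms set_integrable_of_integrable unfolding set_integrable_def by (auto intro!: integrable_abs)
  qed (use assms(4) in \<open>auto split: split_indicator\<close>)
  finally show ?thesis by (simp add: set_lebesgue_integral_def)
qed

lemma one_lipschitz_continuous:
  fixes h :: "real \<Rightarrow> real"
  assumes "\<forall>x y. \<bar>h x - h y\<bar> \<le> \<bar>x - y\<bar>"
  shows "continuous_on A h"
proof -
  have "1-lipschitz_on A h" using assms by (auto simp: lipschitz_on_def dist_real_def)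
  then show ?thesis by (rule lipschitz_on_continuous_on)
qed

lemma integrable_one_lipschitz_normal:
  fixes h :: "real \<Rightarrow> real"
  assumes lip: "\<forall>x y. \<bar>h x - h y\<bar> \<le> \<bar>x - y\<bar>" and "\<sigma> > 0"
  shows "integrable lborel (\<lambda>t. h t * normal_density 0 \<sigma> t)"
proof (rule Bochner_Integration.integrable_bound)
  \<comment> \<open>The majorant comes from the linear growth
    \<open>\<bar>h t\<bar> \<le> \<bar>h 0\<bar> + \<bar>t\<bar>\<close>.\<close>
  show "integrable lborel (\<lambda>t. \<bar>h 0\<bar> * normal_density 0 \<sigma> t + normal_density 0 \<sigma> t * \<bar>t - 0\<bar> ^ 1)"
    using integrable_normal_moment_abs[OF \<open>\<sigma> > 0\<close>, of 0 1] integrable_normal_density[OF \<open>\<sigma> > 0\<close>, of 0] by simp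
  have [measurable]: "h \<in> borel_measurable borel"
    using lip by (intro borel_measurable_continuous_onI one_lipschitz_continuous)
  show "(\<lambda>t. h t * normal_density 0 \<sigma> t) \<in> borel_measurable lborel" by simp
  have "\<bar>h t\<bar> \<le> \<bar>h 0\<bar> + \<bar>t\<bar>" for t using spec[OF spec[OF lip], of t 0] by linarith
  from mult_right_mono[OF this normal_density_nonneg]
  show "AE t in lborel. norm (h t * normal_density 0 \<sigma> t)
      \<le> norm (\<bar>h 0\<bar> * normal_density 0 \<sigma> t + normal_density 0 \<sigma> t * \<bar>t - 0\<bar> ^ 1)"
    by (auto simp: abs_mult algebra_simps)
qed

text \<open>Let f solve \<open>\<sigma>\<^sup>2 * f' w - w * f w = h w - c\<close>, where c is the
  Gaussian mean of \<open>h\<close>. With the density as integrating factor, the derivative of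
  \<open>\<sigma>\<^sup>2\<close> times density times f is the density times \<open>h - c\<close>;
  this is the solution obtained by integrating from the lower end.\<close>

definition stein_solution :: "real \<Rightarrow> (real \<Rightarrow> real) \<Rightarrow> real \<Rightarrow> real" where
  "stein_solution \<sigma> h w =
     (LINT t:{..w}|lborel. (h t - (\<integral>s. h s * normal_density 0 \<sigma> s \<partial>lborel)) * normal_density 0 \<sigma> t)
       / (\<sigma>\<^sup>2 * normal_density 0 \<sigma> w)"

text \<open>The Stein equation solved for the derivative. The equation thus holds by definition, and
  what needs proof is that this is the derivative of \<open>stein_solution\<close>.\<close>

definition stein_solution_deriv :: "real \<Rightarrow> (real \<Rightarrow> real) \<Rightarrow> real \<Rightarrow> real" where
  "stein_solution_deriv \<sigma> h w =
     (w * stein_solution \<sigma> h w + h w - (\<integral>s. h s * normal_density 0 \<sigma> s \<partial>lborel)) / \<sigma>\<^sup>2"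

context
  fixes h :: "real \<Rightarrow> real" and \<sigma> :: real
  assumes lip: "\<forall>x y. \<bar>h x - h y\<bar> \<le> \<bar>x - y\<bar>" and sigma_pos: "\<sigma> > 0"
begin

lemma DERIV_stein_solution:
  "(stein_solution \<sigma> h has_real_derivative stein_solution_deriv \<sigma> h w) (at w)"
proof -
  define c where "c = (\<integral>s. h s * normal_density 0 \<sigma> s \<partial>lborel)"
  have pos: "normal_density 0 \<sigma> w > 0" using sigma_pos by (rule normal_density_pos)
  have "integrable lborel (\<lambda>t. (h t - c) * normal_density 0 \<sigma> t)"
    using integrable_one_lipschitz_normal[OF lip sigma_pos] integrable_normal_density[OF sigma_pos, of 0]
    by (simp add: left_diff_distrib)
  then have "((\<lambda>w. LINT t:{..w}|lborel. (h t - c) * normal_density 0 \<sigma> t) has_real_derivative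
      (h w - c) * normal_density 0 \<sigma> w) (at w)"
    by (intro DERIV_set_integral_atMost) (auto intro!: continuous_intros one_lipschitz_continuous[OF lip])
  then show ?thesis
    unfolding stein_solution_def[abs_def] stein_solution_deriv_def c_def[symmetric]
    using sigma_pos pos
    by (auto intro!: derivative_eq_intros DERIV_normal_density simp: stein_solution_def c_def)
      (simp add: field_simps power2_eq_square)
qed

text \<open>With \<open>h w\<close> subtracted from \<open>h\<close>, the derivative of \<open>w * f w\<close> is a difference of the integrals of
  \<open>h\<close> below and above \<open>w\<close>, with nonnegative coefficients (the truncated second moments). So it is
  extremal for \<open>h t = t\<close> up to sign, and there \<open>f\<close> is constantly \<open>- 1\<close>.\<close>

lemma abs_deriv_id_times_stein_solution:
  "\<bar>stein_solution \<sigma> h w + w * stein_solution_deriv \<sigma> h w\<bar> \<le> 1"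
proof -
  let ?\<phi> = "normal_density 0 \<sigma>"
  define c where "c = (\<integral>s. h s * ?\<phi> s \<partial>lborel)"
  define P Q where "P = (LINT t:{..w}|lborel. ?\<phi> t)" and "Q = (LINT t:{w<..}|lborel. ?\<phi> t)"
  define A B where "A = (LINT t:{..w}|lborel. (h t - h w) * ?\<phi> t)"
    and "B = (LINT t:{w<..}|lborel. (h t - h w) * ?\<phi> t)"
  define L1 U1 where "L1 = (LINT t:{..w}|lborel. (w - t) * ?\<phi> t)"
    and "U1 = (LINT t:{w<..}|lborel. (t - w) * ?\<phi> t)"
  define L2 U2 where "L2 = (LINT t:{..w}|lborel. (t - w)\<^sup>2 * ?\<phi> t)"
    and "U2 = (LINT t:{w<..}|lborel. (t - w)\<^sup>2 * ?\<phi> t)"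
  note ih = integrable_one_lipschitz_normal[OF lip sigma_pos]
  note i = integrable_normal_density[OF sigma_pos, of 0]
  note i1 = integrable_monomial_normal(1)[OF sigma_pos]
  have iw: "integrable lborel (\<lambda>t. (h t - a) * ?\<phi> t)" for a
    using ih i by (simp add: left_diff_distrib)
  have pos: "?\<phi> w > 0" using sigma_pos by (rule normal_density_pos)
  have PQ: "P + Q = 1"
    using set_integral_atMost_greaterThan[OF i, of w] sigma_pos by (simp add: P_def Q_def)
  have "A + B = (\<integral>t. (h t - h w) * ?\<phi> t \<partial>lborel)"
    using set_integral_atMost_greaterThan[OF iw] by (simp add: A_def B_def)
  also have "\<dots> = c - h w"
    using ih i sigma_pos by (simp add: left_diff_distrib c_def)
  finally have AB: "A + B = c - h w" .
  \<comment> \<open>Recentring at \<open>h w\<close>: the mean enters only through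
    \<open>c - h w = A + B\<close>, and \<open>P + Q = 1\<close> makes the result symmetric in the
    two sides.\<close>
  have "(LINT t:{..w}|lborel. (h t - c) * ?\<phi> t)
      = (LINT t:{..w}|lborel. (h t - h w) * ?\<phi> t - (c - h w) * ?\<phi> t)"
    by (simp add: algebra_simps)
  also have "\<dots> = A - (c - h w) * P"
    using iw i by (subst set_integral_diff) (auto simp: A_def P_def intro!: set_integrable_of_integrable)
  also have "\<dots> = A * Q - B * P"
    using PQ unfolding AB[symmetric] by algebra
  finally have f: "\<sigma>\<^sup>2 * ?\<phi> w * stein_solution \<sigma> h w = A * Q - B * P"
    using pos sigma_pos by (simp add: stein_solution_def c_def)
  have f': "\<sigma>\<^sup>2 * stein_solution_deriv \<sigma> h w = w * stein_solution \<sigma> h w - (A + B)"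
    using sigma_pos AB by (simp add: stein_solution_deriv_def c_def)
  note M = normal_truncated_moments[OF sigma_pos, of w, folded P_def Q_def L1_def U1_def L2_def U2_def]
  \<comment> \<open>Eliminating the derivative leaves \<open>(\<sigma>\<^sup>2 + w\<^sup>2) * (A * Q
    - B * P) - \<sigma>\<^sup>2 * ?\<phi> w * w * (A + B)\<close>. Collecting \<open>A\<close> and
    \<open>B\<close> produces the truncated second moments.\<close>
  have D: "\<sigma>\<^sup>2 * (\<sigma>\<^sup>2 * ?\<phi> w) * (stein_solution \<sigma> h w + w * stein_solution_deriv \<sigma> h w) = A * U2 - B * L2"
    using f f' M by algebra
  have AL: "\<bar>A\<bar> \<le> L1" and BU: "\<bar>B\<bar> \<le> U1"
  proof -
    have b: "\<bar>(h t - h w) * ?\<phi> t\<bar> \<le> \<bar>t - w\<bar> * ?\<phi> t" for t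
      unfolding abs_mult using lip by (auto intro!: mult_mono)
    have k: "integrable lborel (\<lambda>t. (w - t) * ?\<phi> t)" "integrable lborel (\<lambda>t. (t - w) * ?\<phi> t)"
      using i i1 by (simp_all add: left_diff_distrib)
    show "\<bar>A\<bar> \<le> L1" unfolding A_def L1_def
      by (rule abs_set_integral_le[OF iw k(1)]) (simp_all add: order_trans[OF b])
    show "\<bar>B\<bar> \<le> U1" unfolding B_def U1_def
      by (rule abs_set_integral_le[OF iw k(2)]) (simp_all add: order_trans[OF b])
  qed
  have L2: "L2 \<ge> 0" and U2: "U2 \<ge> 0"
    unfolding L2_def U2_def set_lebesgue_integral_def by (auto intro!: integral_nonneg_AE)
  have "\<bar>\<sigma>\<^sup>2 * (\<sigma>\<^sup>2 * ?\<phi> w) * (stein_solution \<sigma> h w + w * stein_solution_deriv \<sigma> h w)\<bar>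
      \<le> \<bar>A\<bar> * U2 + \<bar>B\<bar> * L2"
    unfolding D using L2 U2 abs_triangle_ineq4[of "A * U2" "B * L2"] by (simp add: abs_mult)
  also have "\<dots> \<le> L1 * U2 + U1 * L2"
    using L2 U2 AL BU by (intro add_mono mult_right_mono)
  \<comment> \<open>The terms in \<open>P * Q\<close> and in the square of the density cancel. What
    remains is exactly the factor on the left of \<open>D\<close>, hence the constant 1.\<close>
  also have "L1 * U2 + U1 * L2 = \<sigma>\<^sup>2 * (\<sigma>\<^sup>2 * ?\<phi> w)"
    using M PQ by algebra
  finally have "\<sigma>\<^sup>2 * (\<sigma>\<^sup>2 * ?\<phi> w) * \<bar>stein_solution \<sigma> h w + w * stein_solution_deriv \<sigma> h w\<bar>
      \<le> \<sigma>\<^sup>2 * (\<sigma>\<^sup>2 * ?\<phi> w) * 1"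
    using pos by (simp add: abs_mult)
  then show ?thesis
    using pos sigma_pos by (subst (asm) mult_le_cancel_left_pos) auto
qed

text \<open>By the Stein equation, \<open>\<sigma>\<^sup>2\<close> times the derivative is, up to a
  constant, the sum of \<open>w * f w\<close> and \<open>h w\<close>. Both are 1-Lipschitz, the
  first by the preceding bound on its derivative.\<close>

lemma stein_solution_deriv_lipschitz:
  "\<sigma>\<^sup>2 * \<bar>stein_solution_deriv \<sigma> h a - stein_solution_deriv \<sigma> h b\<bar> \<le> 2 * \<bar>a - b\<bar>"
proof -
  have 1: "norm (a * stein_solution \<sigma> h a - b * stein_solution \<sigma> h b) \<le> 1 * norm (a - b)"
  proof (rule field_differentiable_bound[OF convex_UNIV])
    show "((\<lambda>w. w * stein_solution \<sigma> h w) has_field_derivative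
        stein_solution \<sigma> h w + w * stein_solution_deriv \<sigma> h w) (at w within UNIV)" for w
      using DERIV_mult[OF DERIV_ident DERIV_stein_solution, of w] by (simp add: mult.commute)
  qed (use abs_deriv_id_times_stein_solution in auto)
  have 2: "\<bar>h a - h b\<bar> \<le> \<bar>a - b\<bar>" using lip by blast
  have eq: "\<sigma>\<^sup>2 * \<bar>stein_solution_deriv \<sigma> h a - stein_solution_deriv \<sigma> h b\<bar>
      = \<bar>(a * stein_solution \<sigma> h a - b * stein_solution \<sigma> h b) + (h a - h b)\<bar>"
  proof -
    have "\<sigma>\<^sup>2 * \<bar>stein_solution_deriv \<sigma> h a - stein_solution_deriv \<sigma> h b\<bar>
      = \<bar>\<sigma>\<^sup>2 * (stein_solution_deriv \<sigma> h a - stein_solution_deriv \<sigma> h b)\<bar>"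
      by (simp add: abs_mult)
    also have "\<sigma>\<^sup>2 * (stein_solution_deriv \<sigma> h a - stein_solution_deriv \<sigma> h b)
      = (a * stein_solution \<sigma> h a - b * stein_solution \<sigma> h b) + (h a - h b)"
      using sigma_pos by (simp add: stein_solution_deriv_def field_simps)
    finally show ?thesis .
  qed
  show ?thesis unfolding eq by (rule order_trans[OF abs_triangle_ineq]) (use 1 2 in simp)
qed

end

section \<open>Summation identities\<close>

text \<open>Abel summation. For a zero-mean sequence and \<open>m = N\<close> the boundary term
  vanishes, leaving a sum over the gaps.\<close>

lemma sum_by_parts_partial_sums:
  fixes x F :: "nat \<Rightarrow> real"
  assumes "m \<ge> 1"
  shows "(\<Sum>n=1..m. x n * F n)
    = (\<Sum>k=1..m. x k) * F m + (\<Sum>n=1..<m. (\<Sum>k=1..n. x k) * (F n - F (n + 1)))"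
  using assms by (induction m rule: nat_induct_at_least) (simp_all add: algebra_simps)

text \<open>The weight \<open>N - 1\<close> of each point is split between its two adjacent gaps, so that each gap
  receives \<open>N\<close>.\<close>

lemma sum_spread_over_gaps:
  fixes G :: "nat \<Rightarrow> real"
  assumes "N \<ge> 1"
  shows "(\<Sum>n=1..<N. (real N - real n) * G n + real n * G (n + 1)) = (real N - 1) * (\<Sum>n=1..N. G n)"
proof -
  \<comment> \<open>Only the upper limit varies in the induction, while \<open>N\<close> stays fixed
    in the weights. The leftover \<open>(real m - 1) * G m\<close> is the missing last term once
    \<open>m = N\<close>.\<close>
  have "(\<Sum>n=1..<m. (real N - real n) * G n + real n * G (n + 1))
      = (real N - 1) * (\<Sum>n=1..<m. G n) + (real m - 1) * G m" if "m \<ge> 1" for m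
    using that by (induction m rule: nat_induct_at_least) (simp_all add: algebra_simps)
  moreover have "(\<Sum>n=1..N. G n) = (\<Sum>n=1..<N. G n) + G N"
    using assms by (cases N) (simp_all add: atLeastLessThanSuc_atLeastAtMost)
  ultimately show ?thesis using assms by (simp add: distrib_left)
qed

section \<open>Comparison and reflection of solutions\<close>

text \<open>Larger partial sums mean smaller reciprocals to subtract, hence larger next terms, so
  the induction carries terms and partial sums together. Positivity passes from the partial sums of
  \<open>x\<close> to those of \<open>y\<close>.\<close>

lemma recursion_solution_monotone_in_start:
  assumes "recursion_solution N x" "recursion_solution N y"
    and pos: "\<And>n. n \<in> {1..N - 1} \<Longrightarrow> (\<Sum>k=1..n. x k) > 0"
    and "x 1 \<le> y 1"
  shows "m \<in> {1..N} \<Longrightarrow> x m \<le> y m \<and> (\<Sum>k=1..m. x k) \<le> (\<Sum>k=1..m. y k)"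
proof (induction m)
  case (Suc m)
  show ?case
  proof (cases "m = 0")
    case True
    then show ?thesis using \<open>x 1 \<le> y 1\<close> by simp
  next
    case False
    then have m: "m \<in> {1..N - 1}" using Suc.prems by auto
    have IH: "x m \<le> y m" "(\<Sum>k=1..m. x k) \<le> (\<Sum>k=1..m. y k)"
      using Suc m by auto
    have "1 / (\<Sum>k=1..m. y k) \<le> 1 / (\<Sum>k=1..m. x k)"
      using IH(2) pos[OF m] by (intro divide_left_mono mult_pos_pos) auto
    moreover have "x (m + 1) = x m - 1 / (\<Sum>k=1..m. x k)" "y (m + 1) = y m - 1 / (\<Sum>k=1..m. y k)"
      using assms(1,2) m unfolding recursion_solution_def by blast+
    ultimately have "x (m + 1) \<le> y (m + 1)" using IH(1) by linarith
    then show ?thesis using IH(2) by simp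
  qed
qed simp

text \<open>As the total is 0, minus the sum of the last \<open>n\<close> terms is the sum of the
  first \<open>N - n\<close>. The recursion for the reflected sequence at \<open>n\<close> is
  therefore the one for \<open>x\<close> at \<open>N - n\<close>.\<close>

lemma recursion_solution_reflect:
  assumes "recursion_solution N x" and zero: "(\<Sum>n=1..N. x n) = 0"
  shows "recursion_solution N (\<lambda>n. - x (N + 1 - n))"
    and "n \<le> N \<Longrightarrow> (\<Sum>k=1..n. - x (N + 1 - k)) = (\<Sum>k=1..N - n. x k)"
proof -
  have S: "(\<Sum>k=1..n. - x (N + 1 - k)) = (\<Sum>k=1..N - n. x k)" if "n \<le> N" for n
    using that
  proof (induction n)
    case 0
    then show ?case using zero by simp
  next
    case (Suc n)
    then have "N - n = Suc (N - Suc n)" by simp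
    then have "(\<Sum>k=1..N - n. x k) = (\<Sum>k=1..N - Suc n. x k) + x (N - n)"
      by simp
    then show ?case using Suc by simp
  qed
  show "n \<le> N \<Longrightarrow> (\<Sum>k=1..n. - x (N + 1 - k)) = (\<Sum>k=1..N - n. x k)" by (rule S)
  show "recursion_solution N (\<lambda>n. - x (N + 1 - n))"
    unfolding recursion_solution_def
  proof
    fix n assume n: "n \<in> {1..N - 1}"
    then have m: "N - n \<in> {1..N - 1}" by auto
    have "N + 1 - n = N - n + 1" using n by auto
    then show "(\<Sum>k = 1..n. - x (N + 1 - k)) \<noteq> 0 \<and>
         - x (N + 1 - (n + 1)) = - x (N + 1 - n) - 1 / (\<Sum>k = 1..n. - x (N + 1 - k))"
      using S[of n] n m assms(1) unfolding recursion_solution_def by auto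
  qed
qed

section \<open>The decreasing zero-mean solution\<close>

context
  fixes N :: nat and x :: "nat \<Rightarrow> real"
  assumes N2: "N \<ge> 2"
    and rec: "recursion_solution N x"
    and anti: "strict_antimono_on {1..N} x"
    and zero: "(\<Sum>n=1..N. x n) = 0"
begin

lemma gap_eq:
  assumes "n \<in> {1..<N}"
  shows "(\<Sum>k=1..n. x k) * (x n - x (n + 1)) = 1"
  using rec assms unfolding recursion_solution_def by auto

lemma gap_pos: "n \<in> {1..<N} \<Longrightarrow> x (n + 1) < x n"
  using anti by (auto simp: monotone_on_def)

lemma partial_sum_pos:
  assumes "n \<in> {1..<N}"
  shows "(\<Sum>k=1..n. x k) > 0"
  using gap_eq[OF assms] gap_pos[OF assms] zero_less_mult_pos2[of "\<Sum>k=1..n. x k" "x n - x (n + 1)"] by simp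

text \<open>Summation by parts against \<open>x\<close> itself: each of the \<open>N - 1\<close>
  gaps contributes 1.\<close>

lemma sum_squares_eq: "(\<Sum>n=1..N. (x n)\<^sup>2) = real N - 1"
proof -
  have "(\<Sum>n=1..N. (x n)\<^sup>2) = (\<Sum>n=1..<N. (\<Sum>k=1..n. x k) * (x n - x (n + 1)))"
    using sum_by_parts_partial_sums[of N x x] N2 zero by (simp add: power2_eq_square)
  also have "\<dots> = (\<Sum>n=1..<N. 1)"
    by (intro sum.cong refl gap_eq)
  finally show ?thesis using N2 by (simp add: of_nat_diff)
qed

text \<open>Of \<open>x\<close> and its reflection, the one that starts lower stays below the other
  in terms and partial sums. Both totals being 0 forces equal last terms, and the reflection ends in
  \<open>- x 1\<close>.\<close>

lemma last_eq_minus_first: "x N = - x 1"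
proof -
  let ?y = "\<lambda>n. - x (N + 1 - n)"
  note R = recursion_solution_reflect[OF rec zero]
  have posx: "(\<Sum>k=1..n. x k) > 0" if "n \<in> {1..N - 1}" for n
    using partial_sum_pos that by auto
  have posy: "(\<Sum>k=1..n. ?y k) > 0" if "n \<in> {1..N - 1}" for n
  proof -
    have "n \<le> N" "N - n \<in> {1..N - 1}" using that by auto
    then show ?thesis using R(2) posx by simp
  qed
  have sy: "(\<Sum>k=1..N. ?y k) = 0" using R(2)[of N] by simp
  have eq: "a N = b N"
    if "\<And>m. m \<in> {1..N} \<Longrightarrow> a m \<le> b m \<and> (\<Sum>k=1..m. a k) \<le> (\<Sum>k=1..m. b k)"
      "(\<Sum>k=1..N. a k) = 0" "(\<Sum>k=1..N. b k) = 0" for a b :: "nat \<Rightarrow> real"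
  proof -
    \<comment> \<open>The last term is minus the sum of the first \<open>N - 1\<close>, so comparing
      the partial sums at \<open>N - 1\<close> gives the inequality opposite to the one between the
      last terms.\<close>
    have "(\<Sum>k=1..N. c k) = (\<Sum>k=1..N-1. c k) + c N" for c :: "nat \<Rightarrow> real"
      using N2 by (cases N) auto
    moreover have "N \<in> {1..N}" "N - 1 \<in> {1..N}" using N2 by auto
    ultimately show ?thesis using that(1)[of N] that(1)[of "N-1"] that(2,3) by fastforce
  qed
  have "x N = ?y N"
  proof (cases "x 1 \<le> ?y 1")
    case True
    then show ?thesis
      using eq[OF recursion_solution_monotone_in_start[OF rec R(1) posx True] zero sy] by simp
  next
    case False
    then have le: "?y 1 \<le> x 1" by simp
    show ?thesis
      using eq[OF recursion_solution_monotone_in_start[OF R(1) rec posy le] sy zero] by simp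
  qed
  then show ?thesis by simp
qed

lemma first_sq_le: "(x 1)\<^sup>2 \<le> real N - 1"
  unfolding sum_squares_eq[symmetric] by (rule member_le_sum) (use N2 in auto)

text \<open>The partial sum up to \<open>n\<close> is the reciprocal of the \<open>n\<close>th gap, so summation by parts turns
  \<open>x n * f (x n)\<close> into difference quotients, that is, into values of \<open>f'\<close> inside the gaps.\<close>

lemma stein_discrepancy_bound:
  fixes f f' :: "real \<Rightarrow> real" and C :: real
  assumes deriv: "\<And>w. (f has_real_derivative f' w) (at w)"
    and lip: "\<And>a b. \<bar>f' a - f' b\<bar> \<le> C * \<bar>a - b\<bar>"
  shows "\<bar>(\<Sum>n=1..N. (real N - 1) / real N * f' (x n) - x n * f (x n))\<bar> \<le> C * (2 * x 1)"
proof -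
  let ?D = "\<lambda>n. f (x n) - f (x (n + 1))"
  have bound: "\<bar>((real N - real n) * f' (x n) + real n * f' (x (n + 1))) / real N
      - (\<Sum>k=1..n. x k) * ?D n\<bar> \<le> C * (x n - x (n + 1))" if n: "n \<in> {1..<N}" for n
  proof -
    have lt: "x (n + 1) < x n" using gap_pos[OF n] .
    obtain z where z: "x (n + 1) < z" "z < x n" "?D n = (x n - x (n + 1)) * f' z"
      using MVT2[OF lt, of f f'] deriv by blast
    have S: "(\<Sum>k=1..n. x k) * ?D n = f' z"
      using gap_eq[OF n] z(3) by (metis mult.assoc mult_1)
    have C: "C \<ge> 0" using order_trans[OF abs_ge_zero lip[of 0 1]] by simp
    have 1: "\<bar>f' (x n) - f' z\<bar> \<le> C * (x n - x (n + 1))"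
      using lip[of "x n" z] mult_left_mono[OF _ C, of "\<bar>x n - z\<bar>" "x n - x (n + 1)"] z by linarith
    have 2: "\<bar>f' (x (n + 1)) - f' z\<bar> \<le> C * (x n - x (n + 1))"
      using lip[of "x (n + 1)" z] mult_left_mono[OF _ C, of "\<bar>x (n + 1) - z\<bar>" "x n - x (n + 1)"] z
      by linarith
    \<comment> \<open>The weights of the two end points of a gap, divided by \<open>N\<close>, form
      a convex combination, so the error is no worse than at one end point.\<close>
    define p where "p = real n / real N"
    have p: "0 \<le> p" "p \<le> 1" using n by (auto simp: p_def)
    have "((real N - real n) * f' (x n) + real n * f' (x (n + 1))) / real N - f' z
        = (1 - p) * (f' (x n) - f' z) + p * (f' (x (n + 1)) - f' z)"
      using n by (simp add: p_def field_simps)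
    also have "\<bar>\<dots>\<bar> \<le> (1 - p) * \<bar>f' (x n) - f' z\<bar> + p * \<bar>f' (x (n + 1)) - f' z\<bar>"
      using p abs_triangle_ineq[of "(1 - p) * (f' (x n) - f' z)" "p * (f' (x (n + 1)) - f' z)"]
      by (simp add: abs_mult)
    also have "\<dots> \<le> (1 - p) * (C * (x n - x (n + 1))) + p * (C * (x n - x (n + 1)))"
      using p 1 2 by (intro add_mono mult_left_mono) auto
    finally show ?thesis unfolding S by (simp add: algebra_simps)
  qed
  \<comment> \<open>The factor in front of \<open>f'\<close> is the variance; spreading it over the
    gaps gives each gap total weight 1, matching the single value \<open>f' z\<close>.\<close>
  have "(\<Sum>n=1..N. (real N - 1) / real N * f' (x n))
      = (\<Sum>n=1..<N. ((real N - real n) * f' (x n) + real n * f' (x (n + 1))) / real N)"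
    using sum_spread_over_gaps[of N "\<lambda>n. f' (x n)"] N2
    by (simp add: sum_distrib_left[symmetric] sum_divide_distrib[symmetric])
  moreover have "(\<Sum>n=1..N. x n * f (x n)) = (\<Sum>n=1..<N. (\<Sum>k=1..n. x k) * ?D n)"
    using sum_by_parts_partial_sums[of N x "\<lambda>n. f (x n)"] N2 zero by simp
  ultimately have "(\<Sum>n=1..N. (real N - 1) / real N * f' (x n) - x n * f (x n))
    = (\<Sum>n=1..<N. ((real N - real n) * f' (x n) + real n * f' (x (n + 1))) / real N
      - (\<Sum>k=1..n. x k) * ?D n)"
    by (simp add: sum_subtractf)
  also have "\<bar>\<dots>\<bar> \<le> (\<Sum>n=1..<N. C * (x n - x (n + 1)))"
    by (rule order_trans[OF sum_abs]) (intro sum_mono bound)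
  \<comment> \<open>The gaps telescope to the range of the points, which is \<open>2 * x 1\<close>
    by the symmetry of the end points.\<close>
  also have "\<dots> = C * (x 1 - x N)"
    using sum_Suc_diff'[of 1 N "\<lambda>n. - x n"] N2 by (simp add: sum_distrib_left[symmetric])
  finally show ?thesis using last_eq_minus_first by simp
qed

section \<open>The empirical distribution and its Wasserstein distance to the Gaussian\<close>

lemma integral_empirical_distribution:
  fixes g :: "real \<Rightarrow> real"
  assumes "g \<in> borel_measurable borel"
  shows "(\<integral>t. g t \<partial>empirical_distribution N x) = (\<Sum>n=1..N. g (x n)) / real N"
proof -
  have "x \<in> measurable (uniform_count_measure {1..N}) borel"
    by (simp add: measurable_def space_uniform_count_measure sets_uniform_count_measure)
  then have "(\<integral>t. g t \<partial>empirical_distribution N x) = (\<integral>n. g (x n) \<partial>uniform_count_measure {1..N})"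
    unfolding empirical_distribution_def using assms by (rule integral_distr)
  also have "\<dots> = (\<Sum>n=1..N. g (x n)) / real N"
    unfolding uniform_count_measure_def
    by (subst lebesgue_integral_point_measure_finite) (auto simp: sum_divide_distrib)
  finally show ?thesis .
qed

lemma mean_empirical_distribution: "mean (empirical_distribution N x) = 0"
  unfolding mean_def using zero by (subst integral_empirical_distribution) auto

lemma variance_empirical_distribution:
  "variance (empirical_distribution N x) = (real N - 1) / real N"
  unfolding variance_def mean_empirical_distribution
  using sum_squares_eq by (subst integral_empirical_distribution) auto

lemma wasserstein_dist_matching_gaussian_le:
  "wasserstein_dist (empirical_distribution N x) (matching_gaussian (empirical_distribution N x))
    \<le> ereal (4 * x 1 / (real N - 1))"
  unfolding wasserstein_dist_def
proof (rule SUP_least)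
  fix h :: "real \<Rightarrow> real"
  assume "h \<in> {h. \<forall>x y. \<bar>h x - h y\<bar> \<le> \<bar>x - y\<bar>}"
  then have lip: "\<forall>x y. \<bar>h x - h y\<bar> \<le> \<bar>x - y\<bar>" by simp
  define \<sigma> where "\<sigma> = sqrt ((real N - 1) / real N)"
  have \<sigma>: "\<sigma> > 0" "\<sigma>\<^sup>2 = (real N - 1) / real N" using N2 by (auto simp: \<sigma>_def)
  define c where "c = (\<integral>s. h s * normal_density 0 \<sigma> s \<partial>lborel)"
  have [measurable]: "h \<in> borel_measurable borel"
    using lip by (intro borel_measurable_continuous_onI one_lipschitz_continuous)
  have gauss: "(\<integral>t. h t \<partial>matching_gaussian (empirical_distribution N x)) = c"
    unfolding matching_gaussian_def mean_empirical_distribution variance_empirical_distribution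
      \<sigma>_def[symmetric] c_def
    by (subst integral_density) (auto simp: mult.commute)
  have "(\<integral>t. h t \<partial>empirical_distribution N x) - c = (\<Sum>n=1..N. h (x n) - c) / real N"
    using N2 by (simp add: integral_empirical_distribution sum_subtractf field_simps)
  \<comment> \<open>The Stein equation at each point.\<close>
  also have "(\<Sum>n=1..N. h (x n) - c)
      = (\<Sum>n=1..N. \<sigma>\<^sup>2 * stein_solution_deriv \<sigma> h (x n) - x n * stein_solution \<sigma> h (x n))"
    using \<sigma>(1) by (simp add: stein_solution_deriv_def c_def)
  finally have eq: "(\<integral>t. h t \<partial>empirical_distribution N x) - c
    = (\<Sum>n=1..N. \<sigma>\<^sup>2 * stein_solution_deriv \<sigma> h (x n) - x n * stein_solution \<sigma> h (x n)) / real N" .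
  have "\<bar>\<Sum>n=1..N. \<sigma>\<^sup>2 * stein_solution_deriv \<sigma> h (x n) - x n * stein_solution \<sigma> h (x n)\<bar>
      \<le> 2 / \<sigma>\<^sup>2 * (2 * x 1)"
    unfolding \<sigma>(2)
  proof (rule stein_discrepancy_bound)
    show "(stein_solution \<sigma> h has_real_derivative stein_solution_deriv \<sigma> h w) (at w)" for w
      using lip \<sigma>(1) by (rule DERIV_stein_solution)
    show "\<bar>stein_solution_deriv \<sigma> h a - stein_solution_deriv \<sigma> h b\<bar>
        \<le> 2 / ((real N - 1) / real N) * \<bar>a - b\<bar>" for a b
      using stein_solution_deriv_lipschitz[OF lip \<sigma>(1), of a b] \<sigma>(1)
      unfolding \<sigma>(2)[symmetric] by (simp add: field_simps)
  qed
  then have "\<bar>(\<integral>t. h t \<partial>empirical_distribution N x) - c\<bar> \<le> 2 / \<sigma>\<^sup>2 * (2 * x 1) / real N"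
    unfolding eq abs_divide abs_of_nat by (rule divide_right_mono) simp
  \<comment> \<open>\<open>\<sigma>\<^sup>2 * real N\<close> is \<open>real N - 1\<close>.\<close>
  also have "\<dots> = 4 * x 1 / (real N - 1)"
    unfolding \<sigma>(2) using N2 by (simp add: field_simps)
  finally show "ereal \<bar>(\<integral>t. h t \<partial>empirical_distribution N x)
      - (\<integral>t. h t \<partial>matching_gaussian (empirical_distribution N x))\<bar> \<le> ereal (4 * x 1 / (real N - 1))"
    unfolding gauss by simp
qed

lemma first_over_count_le: "x 1 / (real N - 1) \<le> 1 / sqrt (ln (real N))"
proof -
  have ln: "ln (real N) > 0" "ln (real N) \<le> real N - 1"
    using N2 ln_le_minus_one[of "real N"] by auto
  have "x 1 \<le> sqrt (real N - 1)"
    using first_sq_le by (rule real_le_rsqrt)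
  moreover have "sqrt (ln (real N)) \<le> sqrt (real N - 1)" using ln(2) by simp
  \<comment> \<open>Each factor is at most the square root of \<open>real N - 1\<close>, the first
    by the sum of squares and the second by \<open>ln N \<le> N - 1\<close>.\<close>
  ultimately have "x 1 * sqrt (ln (real N)) \<le> sqrt (real N - 1) * sqrt (real N - 1)"
    using ln N2 by (intro mult_mono) auto
  also have "\<dots> = real N - 1" using N2 by simp
  finally show ?thesis using ln N2 by (simp add: field_simps)
qed

end

theorem mainTheorem3:
  fixes N :: nat and x :: "nat \<Rightarrow> real"
  assumes "N \<ge> 3"
    and "recursion_solution N x"
    and "strict_antimono_on {1..N} x"
    and "(\<Sum>n=1..N. x n) = 0"
  shows "let P = empirical_distribution N x in
      wasserstein_dist P (matching_gaussian P) \<le> ereal (4 * x 1 / (real N - 1)) \<and>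
      wasserstein_dist P (matching_gaussian P) \<le> ereal (4 / sqrt (ln (real N)))"
proof -
  have N2: "N \<ge> 2" using assms(1) by simp
  note W = wasserstein_dist_matching_gaussian_le[OF N2 assms(2-4)]
  have "4 * x 1 / (real N - 1) \<le> 4 / sqrt (ln (real N))"
    using first_over_count_le[OF N2 assms(2-4)] by simp
  then show ?thesis
    unfolding Let_def using W order_trans[OF W] by simp
qed

end
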